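(* For $\mathcal{L}\in\{\mathsf{IEL}^-,\mathsf{IEL}\}$ and every formula $A$: if $\mathcal{L}\vdash A$ then $\mathcal{L}\Vdash A$, i.e. $A$ is true in every $\mathcal{L}$-model.
   Context: Formulas are built from a countably infinite set of propositional letters and $\bot$ using $\land,\lor,\rightarrow$ and a unary operator $\mathbf{K}$; $\neg A$ abbreviates $A\rightarrow\bot$. The system $\mathsf{IEL}^-$ has as axioms all instances, in this language, of: the axioms of intuitionistic propositional logic; distribution $\mathbf{K}(A\rightarrow B)\rightarrow(\mathbf{K}A\rightarrow\mathbf{K}B)$; co-reflection $A\rightarrow\mathbf{K}A$. The only rule is Modus Ponens. $\mathsf{IEL}$ is $\mathsf{IEL}^-$ plus all instances of intuitionistic reflection $\mathbf{K}A\rightarrow\neg\neg A$. $\mathcal{L}\vdash A$ means $A$ is derivable in $\mathcal{L}$. An $\mathsf{IEL}^-$-model is a quadruple $\langle W,R,\Vdash,E\rangle$ where $\langle W,R\rangle$ is a non-empty partial order; $\Vdash$ is a monotonic evaluation of propositional letters (if $u\Vdash p$ and $uRv$ then $v\Vdash p$); $E$ is a binary relation on $W$ such that, writing $R(u)=\{v: uRv\}$ and $E(u)=\{v: uEv\}$, $E(u)\subseteq R(u)$ for all $u$, and $uRv$ implies $E(v)\subseteq E(u)$. Forcing is extended to all formulas by the usual intuitionistic Kripke clauses ($u\nVdash\bot$; $u\Vdash A\land B$ iff $u\Vdash A$ and $u\Vdash B$; $u\Vdash A\lor B$ iff $u\Vdash A$ or $u\Vdash B$; $u\Vdash A\rightarrow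 B$ iff for all $v\in R(u)$, $v\Vdash A$ implies $v\Vdash B$) and $u\Vdash\mathbf{K}A$ iff $v\Vdash A$ for all $v\in E(u)$. An $\mathsf{IEL}$-model is an $\mathsf{IEL}^-$-model in which $E(u)\neq\emptyset$ for every $u\in W$. A formula is true in a model if it is forced at every world of it. *)

theory Defs
  imports Main
begin

section \<open>Formulas\<close>

datatype fm =
    Letter nat
  | Falsum  ("\<^bold>\<bottom>")
  | And fm fm  (infixr "\<^bold>\<and>" 55)
  | Or fm fm  (infixr "\<^bold>\<or>" 50)
  | Imp fm fm  (infixr "\<^bold>\<rightarrow>" 45)
  | Know fm  ("\<^bold>K _" [70] 70)

abbreviation Neg :: "fm \<Rightarrow> fm"  ("\<^bold>\<not> _" [70] 70) where
  "\<^bold>\<not> A \<equiv> A \<^bold>\<rightarrow> \<^bold>\<bottom>"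

section \<open>The two calculi\<close>

inductive ipc_axiom :: "fm \<Rightarrow> bool" where
  "ipc_axiom (A \<^bold>\<rightarrow> (B \<^bold>\<rightarrow> A))"
| "ipc_axiom ((A \<^bold>\<rightarrow> (B \<^bold>\<rightarrow> C)) \<^bold>\<rightarrow> ((A \<^bold>\<rightarrow> B) \<^bold>\<rightarrow> (A \<^bold>\<rightarrow> C)))"
| "ipc_axiom ((A \<^bold>\<and> B) \<^bold>\<rightarrow> A)"
| "ipc_axiom ((A \<^bold>\<and> B) \<^bold>\<rightarrow> B)"
| "ipc_axiom (A \<^bold>\<rightarrow> (B \<^bold>\<rightarrow> (A \<^bold>\<and> B)))"
| "ipc_axiom (A \<^bold>\<rightarrow> (A \<^bold>\<or> B))"
| "ipc_axiom (B \<^bold>\<rightarrow> (A \<^bold>\<or> B))"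
| "ipc_axiom ((A \<^bold>\<rightarrow> C) \<^bold>\<rightarrow> ((B \<^bold>\<rightarrow> C) \<^bold>\<rightarrow> ((A \<^bold>\<or> B) \<^bold>\<rightarrow> C)))"
| "ipc_axiom (\<^bold>\<bottom> \<^bold>\<rightarrow> A)"

datatype logic = IEL_minus | IEL

inductive derivable :: "logic \<Rightarrow> fm \<Rightarrow> bool"  (infix "\<turnstile>" 40) for L :: logic where
  ipc: "ipc_axiom A \<Longrightarrow> L \<turnstile> A"
| distribution: "L \<turnstile> \<^bold>K (A \<^bold>\<rightarrow> B) \<^bold>\<rightarrow> (\<^bold>K A \<^bold>\<rightarrow> \<^bold>K B)"
| co_reflection: "L \<turnstile> A \<^bold>\<rightarrow> \<^bold>K A"
| reflection: "L = IEL \<Longrightarrow> L \<turnstile> \<^bold>K A \<^bold>\<rightarrow> \<^bold>\<not> \<^bold>\<not> A"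
| modus_ponens: "L \<turnstile> A \<^bold>\<rightarrow> B \<Longrightarrow> L \<turnstile> A \<Longrightarrow> L \<turnstile> B"


section \<open>Kripke models\<close>

text \<open>The set of worlds is an explicit carrier; \<open>R``{u}\<close> and \<open>E``{u}\<close> are the sets \<open>R(u)\<close>
  and \<open>E(u)\<close>. Values of \<open>val\<close> at points outside the carrier are irrelevant.\<close>

record 'w kripke =
  worlds :: "'w set"
  R :: "'w rel"
  val :: "'w \<Rightarrow> nat \<Rightarrow> bool"
  E :: "'w rel"

definition iel_minus_model :: "'w kripke \<Rightarrow> bool" where
  "iel_minus_model M \<longleftrightarrow>
     worlds M \<noteq> {} \<and> partial_order_on (worlds M) (R M) \<and>
     (\<forall>u v p. val M u p \<and> (u, v) \<in> R M \<longrightarrow> val M v p) \<and>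
     E M \<subseteq> worlds M \<times> worlds M \<and>
     (\<forall>u\<in>worlds M. E M `` {u} \<subseteq> R M `` {u}) \<and>
     (\<forall>u v. (u, v) \<in> R M \<longrightarrow> E M `` {v} \<subseteq> E M `` {u})"

definition iel_model :: "'w kripke \<Rightarrow> bool" where
  "iel_model M \<longleftrightarrow> iel_minus_model M \<and> (\<forall>u\<in>worlds M. E M `` {u} \<noteq> {})"

fun is_model :: "logic \<Rightarrow> 'w kripke \<Rightarrow> bool" where
  "is_model IEL_minus M = iel_minus_model M"
| "is_model IEL M = iel_model M"

primrec forces :: "'w kripke \<Rightarrow> 'w \<Rightarrow> fm \<Rightarrow> bool" where
  "forces M u (Letter p) \<longleftrightarrow> val M u p"
| "forces M u \<^bold>\<bottom> \<longleftrightarrow> False"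
| "forces M u (A \<^bold>\<and> B) \<longleftrightarrow> forces M u A \<and> forces M u B"
| "forces M u (A \<^bold>\<or> B) \<longleftrightarrow> forces M u A \<or> forces M u B"
| "forces M u (A \<^bold>\<rightarrow> B) \<longleftrightarrow> (\<forall>v\<in>R M `` {u}. forces M v A \<longrightarrow> forces M v B)"
| "forces M u (\<^bold>K A) \<longleftrightarrow> (\<forall>v\<in>E M `` {u}. forces M v A)"

definition true_in :: "'w kripke \<Rightarrow> fm \<Rightarrow> bool" where
  "true_in M A \<longleftrightarrow> (\<forall>u\<in>worlds M. forces M u A)"

end

theory Submission
  imports Defs
begin

lemma
  assumes "iel_minus_model M"
  shows iel_minus_model_R_worlds: "(u, v) \<in> R M \<Longrightarrow> u \<in> worlds M \<and> v \<in> worlds M"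
    and iel_minus_model_R_refl: "u \<in> worlds M \<Longrightarrow> (u, u) \<in> R M"
    and iel_minus_model_R_trans: "(u, v) \<in> R M \<Longrightarrow> (v, w) \<in> R M \<Longrightarrow> (u, w) \<in> R M"
    and iel_minus_model_val_mono: "(u, v) \<in> R M \<Longrightarrow> val M u p \<Longrightarrow> val M v p"
    and iel_minus_model_E_imp_R: "(u, v) \<in> E M \<Longrightarrow> (u, v) \<in> R M"
    and iel_minus_model_E_antimono: "(u, v) \<in> R M \<Longrightarrow> (v, w) \<in> E M \<Longrightarrow> (u, w) \<in> E M"
proof -
  have R: "R M \<subseteq> worlds M \<times> worlds M" "refl_on (worlds M) (R M)" "trans (R M)"
    using assms by (simp_all add: iel_minus_model_def partial_order_on_def preorder_on_def)
  show "(u, v) \<in> R M \<Longrightarrow> u \<in> worlds M \<and> v \<in> worlds M"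
    using R(1) by blast
  show "u \<in> worlds M \<Longrightarrow> (u, u) \<in> R M"
    using R(2) by (rule refl_onD)
  show "(u, v) \<in> R M \<Longrightarrow> (v, w) \<in> R M \<Longrightarrow> (u, w) \<in> R M"
    using R(3) by (rule transD)
  show "(u, v) \<in> R M \<Longrightarrow> val M u p \<Longrightarrow> val M v p"
    using assms unfolding iel_minus_model_def by blast
  show "(u, v) \<in> E M \<Longrightarrow> (u, v) \<in> R M"
    using assms unfolding iel_minus_model_def by blast
  show "(u, v) \<in> R M \<Longrightarrow> (v, w) \<in> E M \<Longrightarrow> (u, w) \<in> E M"
    using assms unfolding iel_minus_model_def by blast
qed

lemma forces_mono:
  assumes "iel_minus_model M" and "(u, v) \<in> R M" and "forces M u A"
  shows "forces M v A"
  using assms(2,3)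
proof (induction A arbitrary: u v)
  case (Imp A B)
  then show ?case
    using iel_minus_model_R_trans[OF assms(1)] by fastforce
qed (auto dest: iel_minus_model_val_mono[OF assms(1)] iel_minus_model_E_antimono[OF assms(1)])

lemma forces_ImpD:
  assumes "iel_minus_model M" and "u \<in> worlds M" and "forces M u (A \<^bold>\<rightarrow> B)" and "forces M u A"
  shows "forces M u B"
  using assms iel_minus_model_R_refl[OF assms(1,2)] by auto

lemma ipc_axiom_forced:
  assumes M: "iel_minus_model M" and "ipc_axiom A" and "u \<in> worlds M"
  shows "forces M u A"
  using assms(2,3)
proof cases
  case (1 A B)
  then show ?thesis using forces_mono[OF M] by auto
next
  case (2 A B C)
  have "forces M x C"
    if "forces M v (A \<^bold>\<rightarrow> (B \<^bold>\<rightarrow> C))" and vw: "(v, w) \<in> R M" and "forces M w (A \<^bold>\<rightarrow> B)"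
      and wx: "(w, x) \<in> R M" and "forces M x A" for v w x
  proof -
    have x: "x \<in> worlds M" using iel_minus_model_R_worlds[OF M wx] ..
    have "forces M x (A \<^bold>\<rightarrow> (B \<^bold>\<rightarrow> C))" and "forces M x (A \<^bold>\<rightarrow> B)"
      using forces_mono[OF M iel_minus_model_R_trans[OF M vw wx] that(1)]
        forces_mono[OF M wx that(3)] .
    then show ?thesis
      using forces_ImpD[OF M x] that(5) by blast
  qed
  then show ?thesis using 2 by simp
next
  case (5 A B)
  then show ?thesis using forces_mono[OF M] by auto
next
  case (8 A C B)
  have "forces M x C"
    if "forces M v (A \<^bold>\<rightarrow> C)" and vw: "(v, w) \<in> R M" and "forces M w (B \<^bold>\<rightarrow> C)"
      and wx: "(w, x) \<in> R M" and "forces M x A \<or> forces M x B" for v w x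
  proof -
    have x: "x \<in> worlds M" using iel_minus_model_R_worlds[OF M wx] ..
    have "forces M x (A \<^bold>\<rightarrow> C)" and "forces M x (B \<^bold>\<rightarrow> C)"
      using forces_mono[OF M iel_minus_model_R_trans[OF M vw wx] that(1)]
        forces_mono[OF M wx that(3)] .
    then show ?thesis
      using forces_ImpD[OF M x] that(5) by blast
  qed
  then show ?thesis using 8 by simp
qed auto

lemma distribution_forced:
  assumes M: "iel_minus_model M"
  shows "forces M u (\<^bold>K (A \<^bold>\<rightarrow> B) \<^bold>\<rightarrow> (\<^bold>K A \<^bold>\<rightarrow> \<^bold>K B))"
proof -
  have "forces M x B"
    if "forces M v (\<^bold>K (A \<^bold>\<rightarrow> B))" "(v, w) \<in> R M" "forces M w (\<^bold>K A)" "(w, x) \<in> E M" for v w x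
  proof (rule forces_ImpD[OF M])
    show "x \<in> worlds M"
      using iel_minus_model_R_worlds[OF M iel_minus_model_E_imp_R[OF M that(4)]] by blast
    show "forces M x (A \<^bold>\<rightarrow> B)"
      using that(1) iel_minus_model_E_antimono[OF M that(2,4)] by (auto simp del: forces.simps(5))
    show "forces M x A"
      using that(3,4) by auto
  qed
  then show ?thesis by simp
qed

lemma co_reflection_forced:
  assumes "iel_minus_model M"
  shows "forces M u (A \<^bold>\<rightarrow> \<^bold>K A)"
  using forces_mono[OF assms iel_minus_model_E_imp_R[OF assms]] by auto

text \<open>Any \<open>w \<in> E(v)\<close> lies above \<open>v\<close> and in \<open>E(u)\<close> for \<open>u\<close> below \<open>v\<close>, so it forces \<open>A\<close>
  and refutes \<open>\<^bold>\<not> A\<close> at \<open>v\<close>.\<close>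

lemma reflection_forced:
  assumes "iel_model M"
  shows "forces M u (\<^bold>K A \<^bold>\<rightarrow> \<^bold>\<not> \<^bold>\<not> A)"
proof -
  have M: "iel_minus_model M" using assms by (simp add: iel_model_def)
  have "\<exists>w. (v, w) \<in> R M \<and> forces M w A"
    if A: "forces M t (\<^bold>K A)" and tv: "(t, v) \<in> R M" for t v
  proof -
    obtain w where w: "(v, w) \<in> E M"
      using assms iel_minus_model_R_worlds[OF M tv] by (auto simp: iel_model_def)
    then show ?thesis
      using A iel_minus_model_E_imp_R[OF M w] iel_minus_model_E_antimono[OF M tv w]
      by auto
  qed
  then show ?thesis by fastforce
qed

lemma is_model_imp_iel_minus_model:
  "is_model L M \<Longrightarrow> iel_minus_model M"
  by (cases L) (simp_all add: iel_model_def)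

lemma derivable_forced:
  assumes "L \<turnstile> A" and "is_model L M" and "u \<in> worlds M"
  shows "forces M u A"
proof -
  note M = is_model_imp_iel_minus_model[OF assms(2)]
  show ?thesis
    using assms(1)
  proof induction
    case (ipc A)
    then show ?case using ipc_axiom_forced[OF M] assms(3) by blast
  next
    case (distribution A B)
    show ?case by (rule distribution_forced[OF M])
  next
    case (co_reflection A)
    show ?case by (rule co_reflection_forced[OF M])
  next
    case (reflection A)
    then show ?case using assms(2) reflection_forced by simp
  next
    case (modus_ponens A B)
    then show ?case using forces_ImpD[OF M assms(3)] by blast
  qed
qed

theorem theorem2:
  fixes L :: logic and A :: fm
  assumes "L \<turnstile> A"
  shows "\<forall>M :: 'w kripke. is_model L M \<longrightarrow> true_in M A"
  using derivable_forced[OF assms] by (auto simp: true_in_def)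

end
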